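(* For integers $m_1\ge3$, $m_2\ge5$, let $n=m_1+m_2$ and consider the instance (of the problem and algorithms in the context) with $w_i=1$ for all $i=1,\dots,n$, $b=(u_1,\ldots,u_{m_1},v_1,\ldots,v_{m_2})$, and $c=\sum_{i=1}^{m_1}u_i+\sum_{j=1}^{m_2}v_j-1$ (so $D=1$), where $u$ and $v$ are as follows. Set $C_1=1$ and $C_k=n(k+1)C_{k-1}$ for $k=2,\ldots,m_2-2$; choose any $\epsilon$ with $0<\epsilon<\frac1{2nC_{m_2-2}}$; and let $$v_1=3-\epsilon C_{m_2-2},\quad v_2=v_3=\tfrac72,\quad v_i=3-\epsilon C_{i-3}\ \ (i=4,\ldots,m_2),\qquad V=\sum_{j=1}^{m_2}v_j .$$ Set $u_2=1$. For $k=3,\ldots,m_1$, recursively let $Q_k=\sum_{i=2}^{k-1}u_i+V-1$, $q_k=m_2+k-1$, and $$u_k=\min\left\{u_{k-1}-1,\ q_ku_{k-1}-Q_k-1,\ \frac{Q_k}{q_k-1}-1,\ -1\right\}.$$ Finally set $$u_1=\min\left\{-2,\ \min_{3\le k\le m_1}\Bigl((k-1)u_k-\sum_{i=2}^{k-1}u_i\Bigr),\ \min_{1\le j\le m_2}\Bigl((m_1+j-1)v_j-\sum_{i=2}^{m_1}u_i-\sum_{\ell=1}^{j-1}v_\ell\Bigr)\right\}.$$ On this family of instances, with the elements scanned in the order $u_1,\ldots,u_{m_1},v_1,\ldots,v_{m_2}$, the time complexities of DTA and NDTA are $$\Theta(m_1+m_2^2)\quad\text{and}\quad\Theta\bigl((m_1+m_2)^2\bigr),$$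 respectively. In particular, if $m_2^2=\Theta(m_1)$, then DTA runs in $\Theta(m_1)$ time, whereas NDTA runs in $\Theta(m_1^2)$ time.
   Context: The problem is (P): minimize $\sum_{i=1}^n w_ix_i^2$ subject to $\sum_{i=1}^n w_ix_i=c$, $x\le b$, with $w\in\mathbb R^n_{++}$ (strictly positive entries), $b\in\mathbb R^n$, $c<\sum_i w_ib_i$. **Dynamic-Threshold Algorithm (DTA).** Assignments are executed sequentially. Step 1. Set $\mathcal J=\emptyset$, $\mathcal S=\{1\}$, $D=\sum_{i=1}^n w_i b_i-c$, $W=w_1$, $\tau=(w_1b_1-D)/W$. Step 2. For $i=2,\ldots,n$: if $b_i>\tau$, set $W\leftarrow W+w_i$ and then $\tau\leftarrow\tau+w_i(b_i-\tau)/W$. Then, with $\rho_i=b_i-D/w_i$: if $\tau>\rho_i$, set $\mathcal S\leftarrow\mathcal S\cup\{i\}$; otherwise (reset) set $\mathcal J\leftarrow\mathcal J\cup\mathcal S$, $\mathcal S\leftarrow\{i\}$, $W\leftarrow w_i$, $\tau\leftarrow\rho_i$. (If $b_i\le\tau$, index $i$ is skipped.) Step 3. If $\mathcal J\ne\emptyset$, for every $j\in\mathcal J$: if $b_j>\tau$, set $\mathcal S\leftarrow\mathcal S\cup\{j\}$, $W\leftarrow W+w_j$, and then $\tau\leftarrow\tau+w_j(b_j-\tau)/W$. Step 4 (removal). Repeat the following pass until a pass leaves $|\mathcal S|$ unchanged: visit every element $i\in\mathcal S$ once; whenever the visited $i$ satisfies $b_i\le\tau$ (with the current $\tau$), set $\mathcal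 S\leftarrow\mathcal S\setminus\{i\}$, $W\leftarrow W-w_i$, and then $\tau\leftarrow\tau+w_i(\tau-b_i)/W$. Step 5. Return $x^*$ with $x_i^*=\tau$ for $i\in\mathcal S$ and $x_i^*=b_i$ for $i\notin\mathcal S$. **No-Reset Dynamic-Threshold Algorithm (NDTA).** Assignments are executed sequentially; there is no set $\mathcal J$ and there are no resets. Step 1. Set $\mathcal S=\{1\}$, $D=\sum_{i=1}^n w_i b_i-c$, $W=w_1$, $\tau=(w_1b_1-D)/W$. Step 2. For $i=2,\ldots,n$: if $b_i>\tau$, set $\mathcal S\leftarrow\mathcal S\cup\{i\}$, $W\leftarrow W+w_i$, and then $\tau\leftarrow\tau+w_i(b_i-\tau)/W$. (If $b_i\le\tau$, index $i$ is skipped.) Step 3 (removal). Repeat the following pass until a pass leaves $|\mathcal S|$ unchanged: visit every element $i\in\mathcal S$ once; whenever the visited $i$ satisfies $b_i\le\tau$ (with the current $\tau$), set $\mathcal S\leftarrow\mathcal S\setminus\{i\}$, $W\leftarrow W-w_i$, and then $\tau\leftarrow\tau+w_i(\tau-b_i)/W$. Step 4. Return $x^*$ with $x_i^*=\tau$ for $i\in\mathcal S$ and $x_i^*=b_i$ for $i\notin\mathcal S$. Conventions: $\mathcal S$ is kept as a list in order of insertion, and each removal pass visits the elements of $\mathcal S$ in that order. Time is the number of elementary operations (each comparison, arithmetic operation on reals, and insertion, deletion or visit of one list element has unit cost), so that, up to constant factors, it is the total number of element examinations over all steps. $\Theta$ is understood with constants independent of $m_1,m_2$ and $\epsilon$.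 *)

theory Defs
  imports Complex_Main "HOL-Library.Landau_Symbols"
begin

text \<open>
  Data of the problem \<open>min (\<Sum>i. w i * (x i)^2)\<close> subject to \<open>(\<Sum>i. w i * x i) = c\<close>, \<open>x i \<le> b i\<close>:
  vectors are functions on \<open>nat\<close> of which only the indices \<open>1, \<dots>, n\<close> are used.

  The last component \<open>t\<close> of a state counts elementary operations. One unit is charged for each
  comparison, each arithmetic operation on reals, and each insertion, deletion or visit of one list
  element. The sets \<open>S\<close> and \<open>J\<close> are lists in order of insertion. Division by a zero \<open>W\<close> never
  happens when all weights and \<open>D\<close> are positive: \<open>W * \<tau> = (\<Sum>i\<in>S. w i * b i) - D\<close> is preserved, so
  the last element of \<open>S\<close> has \<open>b i > \<tau>\<close> and is not removed.
\<close>

type_synonym vec = "nat \<Rightarrow> real"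

type_synonym state = "nat list \<times> real \<times> real \<times> nat"

text \<open>
  The update \<open>W \<leftarrow> W + w i; \<tau> \<leftarrow> \<tau> + w i * (b i - \<tau>) / W\<close> takes 1 + 4 operations, and so does
  the update for a removal. Every examined index costs one visit and one comparison.
\<close>

fun add_step :: "vec \<Rightarrow> vec \<Rightarrow> nat \<Rightarrow> state \<Rightarrow> state" where
  "add_step w b i (S, W, \<tau>, t) =
     (if b i > \<tau>
      then let W' = W + w i;
               \<tau>' = \<tau> + w i * (b i - \<tau>) / W'
           in (S @ [i], W', \<tau>', t + 2 + 1 + 5)
      else (S, W, \<tau>, t + 2))"

text \<open>
  Computing \<open>\<rho>\<close> takes 2 operations and its comparison with \<open>\<tau>'\<close> takes 1. A reset inserts the
  \<open>length S\<close> elements of \<open>S\<close> into \<open>J\<close> and \<open>i\<close> into the new \<open>S\<close>.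
\<close>

fun dta_scan :: "vec \<Rightarrow> vec \<Rightarrow> real \<Rightarrow> nat \<Rightarrow> nat list \<times> state \<Rightarrow> nat list \<times> state" where
  "dta_scan w b D i (J, S, W, \<tau>, t) =
     (if b i > \<tau>
      then let W' = W + w i;
               \<tau>' = \<tau> + w i * (b i - \<tau>) / W';
               \<rho> = b i - D / w i
           in if \<tau>' > \<rho>
              then (J, S @ [i], W', \<tau>', t + 2 + 5 + 3 + 1)
              else (J @ S, [i], w i, \<rho>, t + 2 + 5 + 3 + length S + 1)
      else (J, S, W, \<tau>, t + 2))"

fun removal_visit :: "vec \<Rightarrow> vec \<Rightarrow> nat \<Rightarrow> state \<Rightarrow> state" where
  "removal_visit w b i (S, W, \<tau>, t) =
     (if b i \<le> \<tau>
      then let W' = W - w i;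
               \<tau>' = \<tau> + w i * (\<tau> - b i) / W'
           in (removeAll i S, W', \<tau>', t + 2 + 1 + 5)
      else (S, W, \<tau>, t + 2))"

definition removal_pass :: "vec \<Rightarrow> vec \<Rightarrow> state \<Rightarrow> state" where
  "removal_pass w b st = fold (removal_visit w b) (fst st) st"

lemma length_removal_fold:
  "length (fst (fold (removal_visit w b) xs st)) \<le> length (fst st)"
proof (induction xs arbitrary: st)
  case Nil
  then show ?case by simp
next
  case (Cons i xs)
  obtain S W \<tau> t where st: "st = (S, W, \<tau>, t)" by (cases st)
  have "length (fst (removal_visit w b i st)) \<le> length (fst st)"
    by (simp add: st Let_def)
  then show ?case using Cons.IH[of "removal_visit w b i st"] by simp
qed

lemma length_removal_pass: "length (fst (removal_pass w b st)) \<le> length (fst st)"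
  by (simp add: removal_pass_def length_removal_fold)

text \<open>Each pass ends with one comparison of the old and the new size of \<open>S\<close>.\<close>

function removal_loop :: "vec \<Rightarrow> vec \<Rightarrow> state \<Rightarrow> state" where
  "removal_loop w b (S, W, \<tau>, t) =
     (case removal_pass w b (S, W, \<tau>, t) of
        (S', W', \<tau>', t') \<Rightarrow>
          if length S' = length S then (S', W', \<tau>', t' + 1)
          else removal_loop w b (S', W', \<tau>', t' + 1))"
  by pat_completeness auto
termination
proof (relation "measure (\<lambda>(w, b, S, W, \<tau>, t). length S)", goal_cases)
  case 1
  show ?case by (rule wf_measure)
next
  case (2 w b S W \<tau> t S' x W' y \<tau>' t')
  have "length S' \<le> length S"
    using length_removal_pass[of w b "(S, W, \<tau>, t)"] 2(1) by (metis fst_conv)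
  with 2(4) show ?case by simp
qed

declare removal_loop.simps [simp del]

text \<open>The output \<open>x\<close> costs one insertion per coordinate and one visit per element of \<open>S\<close>.\<close>

fun result :: "nat \<Rightarrow> vec \<Rightarrow> state \<Rightarrow> vec \<times> nat" where
  "result n b (S, W, \<tau>, t) = ((\<lambda>i. if i \<in> set S then \<tau> else b i), t + n + length S)"

definition excess :: "nat \<Rightarrow> vec \<Rightarrow> vec \<Rightarrow> real \<Rightarrow> real" where
  "excess n w b c = (\<Sum>i=1..n. w i * b i) - c"

text \<open>Computing \<open>D\<close> takes \<open>2 * n\<close> operations, \<open>\<tau>\<close> takes 3 more, and 1 is inserted into \<open>S\<close>.\<close>

definition init :: "nat \<Rightarrow> vec \<Rightarrow> vec \<Rightarrow> real \<Rightarrow> state" where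
  "init n w b D = ([1], w 1, (w 1 * b 1 - D) / w 1, 2 * n + 3 + 1)"

text \<open>One unit is charged for testing whether \<open>J\<close> is empty; if it is, the second \<open>fold\<close> does nothing.\<close>

definition dta :: "nat \<Rightarrow> vec \<Rightarrow> vec \<Rightarrow> real \<Rightarrow> vec \<times> nat" where
  "dta n w b c =
     (let D = excess n w b c;
          (J, S, W, \<tau>, t) = fold (dta_scan w b D) [2..<n + 1] ([], init n w b D);
          st = fold (add_step w b) J (S, W, \<tau>, t + 1)
      in result n b (removal_loop w b st))"

definition ndta :: "nat \<Rightarrow> vec \<Rightarrow> vec \<Rightarrow> real \<Rightarrow> vec \<times> nat" where
  "ndta n w b c =
     (let D = excess n w b c;
          st = fold (add_step w b) [2..<n + 1] (init n w b D)
      in result n b (removal_loop w b st))"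

definition dta_time :: "nat \<Rightarrow> vec \<Rightarrow> vec \<Rightarrow> real \<Rightarrow> nat" where
  "dta_time n w b c = snd (dta n w b c)"

definition ndta_time :: "nat \<Rightarrow> vec \<Rightarrow> vec \<Rightarrow> real \<Rightarrow> nat" where
  "ndta_time n w b c = snd (ndta n w b c)"

text \<open>The value at index 0 is not used.\<close>

fun C_seq :: "nat \<Rightarrow> nat \<Rightarrow> real" where
  "C_seq n 0 = 0"
| "C_seq n (Suc 0) = 1"
| "C_seq n (Suc (Suc k)) = real n * (real (Suc (Suc k)) + 1) * C_seq n (Suc k)"

definition v_seq :: "nat \<Rightarrow> nat \<Rightarrow> real \<Rightarrow> nat \<Rightarrow> real" where
  "v_seq m1 m2 \<epsilon> j =
     (if j = 1 then 3 - \<epsilon> * C_seq (m1 + m2) (m2 - 2)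
      else if j = 2 \<or> j = 3 then 7 / 2
      else 3 - \<epsilon> * C_seq (m1 + m2) (j - 3))"

definition V_sum :: "nat \<Rightarrow> nat \<Rightarrow> real \<Rightarrow> real" where
  "V_sum m1 m2 \<epsilon> = (\<Sum>j=1..m2. v_seq m1 m2 \<epsilon> j)"

text \<open>The entries of \<open>u\<close> with index at least 2; the values at indices 0 and 1 are not used.\<close>

function u_tail :: "nat \<Rightarrow> real \<Rightarrow> nat \<Rightarrow> real" where
  "u_tail m2 V k =
     (if k \<le> 2 then 1
      else let Q = (\<Sum>i=2..<k. u_tail m2 V i) + V - 1;
               q = real (m2 + k - 1);
               p = u_tail m2 V (k - 1)
           in Min {p - 1, q * p - Q - 1, Q / (q - 1) - 1, -1})"
  by pat_completeness auto
termination
  by (relation "measure (\<lambda>(m2, V, k). k)") auto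

declare u_tail.simps [simp del]

definition u_seq :: "nat \<Rightarrow> nat \<Rightarrow> real \<Rightarrow> nat \<Rightarrow> real" where
  "u_seq m1 m2 \<epsilon> k =
     (let u = u_tail m2 (V_sum m1 m2 \<epsilon>);
          v = v_seq m1 m2 \<epsilon>
      in if k = 1
         then Min ({-2}
           \<union> (\<lambda>k. real (k - 1) * u k - (\<Sum>i=2..<k. u i)) ` {3..m1}
           \<union> (\<lambda>j. real (m1 + j - 1) * v j - (\<Sum>i=2..m1. u i) - (\<Sum>l=1..<j. v l)) ` {1..m2})
         else u k)"

definition inst_w :: vec where
  "inst_w i = 1"

definition inst_b :: "nat \<Rightarrow> nat \<Rightarrow> real \<Rightarrow> vec" where
  "inst_b m1 m2 \<epsilon> i = (if i \<le> m1 then u_seq m1 m2 \<epsilon> i else v_seq m1 m2 \<epsilon> (i - m1))"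

definition inst_c :: "nat \<Rightarrow> nat \<Rightarrow> real \<Rightarrow> real" where
  "inst_c m1 m2 \<epsilon> = (\<Sum>i=1..m1. u_seq m1 m2 \<epsilon> i) + (\<Sum>j=1..m2. v_seq m1 m2 \<epsilon> j) - 1"

definition instances :: "(nat \<times> nat \<times> real) set" where
  "instances =
     {(m1, m2, \<epsilon>). m1 \<ge> 3 \<and> m2 \<ge> 5 \<and>
        0 < \<epsilon> \<and> \<epsilon> < 1 / (2 * real (m1 + m2) * C_seq (m1 + m2) (m2 - 2))}"

definition T_dta :: "nat \<times> nat \<times> real \<Rightarrow> real" where
  "T_dta = (\<lambda>(m1, m2, \<epsilon>).
     real (dta_time (m1 + m2) inst_w (inst_b m1 m2 \<epsilon>) (inst_c m1 m2 \<epsilon>)))"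

definition T_ndta :: "nat \<times> nat \<times> real \<Rightarrow> real" where
  "T_ndta = (\<lambda>(m1, m2, \<epsilon>).
     real (ndta_time (m1 + m2) inst_w (inst_b m1 m2 \<epsilon>) (inst_c m1 m2 \<epsilon>)))"

text \<open>
  With the filter \<open>principal instances\<close>, the bounds expressed by \<open>\<Theta>\<close> hold at every instance, with
  constants that depend on none of \<open>m1\<close>, \<open>m2\<close>, \<open>\<epsilon>\<close>. A filter \<open>F \<le> principal instances\<close> stands for a
  subfamily: \<open>principal A\<close> with \<open>A \<subseteq> instances\<close>, or \<open>filtermap s sequentially\<close> for a sequence \<open>s\<close>
  of instances.
\<close>

end

theory Submission
  imports Defs
begin

text \<open>
  For unit weights and \<open>D = 1\<close> every state is determined by its list \<open>S\<close>: \<open>W\<close> is the length of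
  \<open>S\<close> and \<open>\<tau> = ((\<Sum>i\<in>S. b i) - 1) / W\<close>. NDTA collects all \<open>n\<close> indices, since \<open>u 1\<close> keeps the
  threshold low. The other \<open>u k\<close> are chosen such that, after \<open>u 1\<close> has been removed, in the list
  \<open>u 2, \<dots>, u k, v 1, \<dots>, v m2\<close> only \<open>u k\<close> lies below the threshold; each pass over \<open>S\<close> therefore
  removes a single \<open>u k\<close>, which gives a cost of order \<open>m1 * (m1 + m2)\<close>. In the same way the rapid
  growth of \<open>C_seq\<close> lets each pass remove only the last of the remaining \<open>v j\<close>, which gives a cost
  of order \<open>m2\<^sup>2\<close>. DTA resets at \<open>u 2\<close> and at \<open>v 1\<close> and skips all other \<open>u k\<close>, so only the
  second cost remains. The upper bounds hold because every pass but the last one shortens \<open>S\<close>.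
\<close>

section \<open>The cost of the removal loop\<close>

text \<open>The constant 8 is the price of a visit that removes: 2 for visit and comparison, 1 for
  the deletion, 5 for the update.\<close>

lemma removal_fold_time:
  "snd (snd (snd (fold (removal_visit w b) xs st))) \<le> snd (snd (snd st)) + 8 * length xs"
proof (induction xs arbitrary: st)
  case (Cons i xs)
  obtain S W \<tau> t where st: "st = (S, W, \<tau>, t)" by (cases st)
  show ?case using Cons.IH[of "removal_visit w b i st"] by (auto simp: st Let_def split: if_splits)
qed simp

lemma removal_loop_length: "length (fst (removal_loop w b st)) \<le> length (fst st)"
proof (induction w b st rule: removal_loop.induct)
  case (1 w b S W \<tau> t)
  obtain S' W' \<tau>' t' where p: "removal_pass w b (S, W, \<tau>, t) = (S', W', \<tau>', t')"
    by (metis prod_cases4)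
  have l: "length S' \<le> length S"
    using length_removal_pass[of w b "(S, W, \<tau>, t)"] by (simp add: p)
  show ?case
    using 1[of S' "(W', \<tau>', t')" W' "(\<tau>', t')" \<tau>' t'] p l by (auto simp: removal_loop.simps[of w b S] p)
qed

text \<open>A pass costs at most \<open>8 * length S + 1\<close> including the final size
  comparison, and there are at most \<open>length S + 1\<close> passes.\<close>

lemma removal_loop_time_le:
  "snd (snd (snd (removal_loop w b st)))
     \<le> snd (snd (snd st)) + (length (fst st) + 1) * (8 * length (fst st) + 1)"
proof (induction w b st rule: removal_loop.induct)
  case (1 w b S W \<tau> t)
  obtain S' W' \<tau>' t' where p: "removal_pass w b (S, W, \<tau>, t) = (S', W', \<tau>', t')"
    by (metis prod_cases4)
  have l: "length S' \<le> length S"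
    using length_removal_pass[of w b "(S, W, \<tau>, t)"] by (simp add: p)
  have t: "t' \<le> t + 8 * length S"
    using removal_fold_time[of w b S "(S, W, \<tau>, t)"] p by (simp add: removal_pass_def)
  show ?case
  proof (cases "length S' = length S")
    case True
    then show ?thesis using t by (simp add: removal_loop.simps[of w b S] p)
  next
    case False
    \<comment> \<open>As \<open>length S' + 1 \<le> length S\<close>, the remaining passes use one
      factor less of the budget, which leaves \<open>8 * length S + 1\<close> for the present
      pass.\<close>
    have "(length S' + 1) * (8 * length S' + 1) \<le> length S * (8 * length S + 1)"
      using l False by (intro mult_mono) auto
    then show ?thesis using 1[of S' "(W', \<tau>', t')" W' "(\<tau>', t')" \<tau>' t'] p t False
      by (simp add: removal_loop.simps[of w b S] p)
  qed
qed

lemma removal_fold_time_ge: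
  "snd (snd (snd st)) \<le> snd (snd (snd (fold (removal_visit w b) xs st)))"
proof (induction xs arbitrary: st)
  case (Cons i xs)
  obtain S W \<tau> t where st: "st = (S, W, \<tau>, t)" by (cases st)
  show ?case using Cons.IH[of "removal_visit w b i st"] by (auto simp: st Let_def split: if_splits)
qed simp

text \<open>Allows a lower bound to follow a run for some passes and to discard the rest.\<close>

lemma removal_loop_time_ge: "snd (snd (snd st)) \<le> snd (snd (snd (removal_loop w b st)))"
proof (induction w b st rule: removal_loop.induct)
  case (1 w b S W \<tau> t)
  obtain S' W' \<tau>' t' where p: "removal_pass w b (S, W, \<tau>, t) = (S', W', \<tau>', t')"
    by (metis prod_cases4)
  have t: "t \<le> t'"
    using removal_fold_time_ge[of "(S, W, \<tau>, t)" w b S] p by (simp add: removal_pass_def)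
  then show ?case
    using 1[of S' "(W', \<tau>', t')" W' "(\<tau>', t')" \<tau>' t'] p by (auto simp: removal_loop.simps[of w b S] p)
qed

section \<open>Unit weights and unit excess\<close>

definition threshold :: "vec \<Rightarrow> nat list \<Rightarrow> real" where
  "threshold b S = (sum_list (map b S) - 1) / real (length S)"

definition canonical :: "vec \<Rightarrow> nat list \<Rightarrow> nat \<Rightarrow> state" where
  "canonical b S t = (S, real (length S), threshold b S, t)"

lemma canonical_eq_iff [simp]: "canonical b S t = canonical b S t' \<longleftrightarrow> t = t'"
  by (simp add: canonical_def)

lemma less_threshold_iff:
  "S \<noteq> [] \<Longrightarrow> x < threshold b S \<longleftrightarrow> real (length S) * x < sum_list (map b S) - 1"
  by (simp add: threshold_def pos_less_divide_eq mult.commute)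

lemma threshold_less_iff:
  "S \<noteq> [] \<Longrightarrow> threshold b S < x \<longleftrightarrow> sum_list (map b S) - 1 < real (length S) * x"
  by (simp add: threshold_def pos_divide_less_eq mult.commute)

lemma le_threshold_iff:
  "S \<noteq> [] \<Longrightarrow> x \<le> threshold b S \<longleftrightarrow> real (length S) * x \<le> sum_list (map b S) - 1"
  by (simp add: threshold_def pos_le_divide_eq mult.commute)

lemma threshold_append:
  assumes "S \<noteq> []"
  shows "threshold b S + (b i - threshold b S) / (real (length S) + 1) = threshold b (S @ [i])"
proof -
  have "sum_list (map b S) - 1 = threshold b S * real (length S)"
    using assms by (simp add: threshold_def)
  moreover have "real (length S) + 1 \<noteq> 0" by linarith
  ultimately show ?thesis by (simp add: threshold_def[of b "S @ [i]"] field_simps)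
qed

text \<open>The new threshold is a convex combination of the old one and \<open>b i\<close>.\<close>

lemma threshold_mono_append:
  assumes "S \<noteq> []" "threshold b S < b i"
  shows "threshold b S < threshold b (S @ [i])"
  using assms(2) by (simp flip: threshold_append[OF assms(1), of b i])

lemma sum_list_removeAll:
  fixes f :: "'a \<Rightarrow> real"
  assumes "distinct S" "i \<in> set S"
  shows "sum_list (map f (removeAll i S)) = sum_list (map f S) - f i"
  using assms by (simp add: sum_list_distinct_conv_sum_set distinct_removeAll sum_diff1)

lemma length_removeAll_distinct:
  assumes "distinct S" "i \<in> set S"
  shows "length (removeAll i S) = length S - 1"
  using assms by (metis distinct_remove1_removeAll length_remove1)

lemma threshold_removeAll:
  assumes "distinct S" "i \<in> set S" "length S \<ge> 2"
  shows "threshold b S + (threshold b S - b i) / (real (length S) - 1) = threshold b (removeAll i S)"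
proof -
  have "sum_list (map b S) - 1 = threshold b S * real (length S)" "real (length S) - 1 \<noteq> 0"
    using assms by (auto simp: threshold_def)
  then show ?thesis using assms
    by (simp add: threshold_def[of b "removeAll i S"] sum_list_removeAll length_removeAll_distinct
        of_nat_diff field_simps)
qed

section \<open>Single steps and single passes between canonical states\<close>

lemma add_step_canonical_less:
  "S \<noteq> [] \<Longrightarrow> threshold b S < b i \<Longrightarrow>
     add_step inst_w b i (canonical b S t) = canonical b (S @ [i]) (t + 8)"
  by (simp add: canonical_def inst_w_def Let_def threshold_append add.commute[of 1])

lemma dta_scan_canonical_add:
  "S \<noteq> [] \<Longrightarrow> threshold b S < b i \<Longrightarrow> b i - 1 < threshold b (S @ [i]) \<Longrightarrow>
     dta_scan inst_w b 1 i (J, canonical b S t) = (J, canonical b (S @ [i]) (t + 11))"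
  by (simp add: canonical_def inst_w_def Let_def threshold_append add.commute[of 1])

lemma dta_scan_canonical_reset:
  "S \<noteq> [] \<Longrightarrow> threshold b S < b i \<Longrightarrow> threshold b (S @ [i]) \<le> b i - 1 \<Longrightarrow>
     dta_scan inst_w b 1 i (J, canonical b S t) = (J @ S, canonical b [i] (t + 11 + length S))"
  by (simp add: canonical_def inst_w_def Let_def threshold_append add.commute[of 1] threshold_def[of _ "[i]"])

lemma dta_scan_canonical_skip:
  "b i \<le> threshold b S \<Longrightarrow>
     dta_scan inst_w b 1 i (J, canonical b S t) = (J, canonical b S (t + 2))"
  by (simp add: canonical_def)

lemma removal_visit_canonical_remove:
  "distinct S \<Longrightarrow> i \<in> set S \<Longrightarrow> length S \<ge> 2 \<Longrightarrow> b i \<le> threshold b S \<Longrightarrow>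
     removal_visit inst_w b i (canonical b S t) = canonical b (removeAll i S) (t + 8)"
  by (simp add: canonical_def inst_w_def Let_def threshold_removeAll length_removeAll_distinct of_nat_diff)

lemma removal_fold_canonical_keep:
  "\<forall>i\<in>set xs. threshold b S < b i \<Longrightarrow>
     fold (removal_visit inst_w b) xs (canonical b S t) = canonical b S (t + 2 * length xs)"
proof (induction xs arbitrary: t)
  case (Cons x xs)
  then have "removal_visit inst_w b x (canonical b S t) = canonical b S (t + 2)"
    by (simp add: canonical_def)
  with Cons show ?case by simp
qed simp

text \<open>Elements before \<open>x\<close> meet the threshold of the whole list, elements after
  \<open>x\<close> the one left by its removal; hence the two kinds of hypotheses. Every visit costs
  2, and the removal adds 6.\<close>

lemma removal_fold_single:
  assumes "distinct (xs @ x # ys)" "xs @ ys \<noteq> []"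
    and "\<forall>i\<in>set xs. threshold b (xs @ x # ys) < b i" "b x \<le> threshold b (xs @ x # ys)"
    and "\<forall>i\<in>set ys. threshold b (xs @ ys) < b i"
  shows "fold (removal_visit inst_w b) (xs @ x # ys) (canonical b (xs @ x # ys) t)
           = canonical b (xs @ ys) (t + 2 * length (xs @ x # ys) + 6)"
proof -
  have "length (xs @ ys) \<ge> 1" using assms(2) by (cases "xs @ ys") auto
  then have l: "length (xs @ x # ys) \<ge> 2" by simp
  have r: "removeAll x (xs @ x # ys) = xs @ ys" using assms(1) by simp
  show ?thesis
    unfolding fold_append fold_simps comp_def removal_fold_canonical_keep[OF assms(3)]
      removal_visit_canonical_remove[OF assms(1) _ l assms(4), simplified] r[simplified]
      using removal_fold_canonical_keep[OF assms(5)] assms(1) by simp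
qed

lemma removal_loop_time_pass:
  assumes "fold (removal_visit w b) (fst st) st = st'"
    and "length (fst st') < length (fst st)"
  shows "snd (snd (snd (removal_loop w b st)))
     = snd (snd (snd (removal_loop w b (fst st', fst (snd st'), fst (snd (snd st')), snd (snd (snd st')) + 1))))"
proof -
  obtain S W \<tau> t where st: "st = (S, W, \<tau>, t)" by (cases st)
  obtain S' W' \<tau>' t' where st': "st' = (S', W', \<tau>', t')" by (cases st')
  show ?thesis using assms
    by (simp add: st st' removal_loop.simps[of w b S] removal_pass_def)
qed

lemma removal_loop_canonical_pass:
  assumes "fold (removal_visit inst_w b) S (canonical b S t) = canonical b S' t'"
    and "length S' < length S"
  shows "snd (snd (snd (removal_loop inst_w b (canonical b S t))))
     = snd (snd (snd (removal_loop inst_w b (canonical b S' (t' + 1)))))"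
  using removal_loop_time_pass[of inst_w b "canonical b S t" "canonical b S' t'"] assms
  by (simp add: canonical_def)

section \<open>The instances\<close>

lemma C_seq_Suc: "k \<ge> 1 \<Longrightarrow> C_seq n (Suc k) = real n * real (k + 2) * C_seq n k"
  by (cases k) auto

lemma C_seq_pos:
  assumes "n \<ge> 1" "k \<ge> 1"
  shows "C_seq n k > 0"
  using assms(2,1)
proof (induction k rule: nat_induct_at_least)
  case (Suc k)
  then show ?case by (simp add: C_seq_Suc)
qed simp

lemma C_seq_nonneg: "n \<ge> 1 \<Longrightarrow> C_seq n k \<ge> 0"
  using C_seq_pos[of n k] by (cases "k = 0") auto

text \<open>Equality holds at \<open>k = Suc j\<close>, and the sequence increases from
  there.\<close>

lemma C_seq_growth:
  assumes "n \<ge> 1" "1 \<le> j" "j < k"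
  shows "real n * real (j + 2) * C_seq n j \<le> C_seq n k"
  using Suc_leI[OF assms(3)]
proof (induction k rule: nat_induct_at_least)
  case base
  then show ?case using assms by (simp add: C_seq_Suc)
next
  case (Suc k)
  then have "C_seq n k \<le> C_seq n (Suc k)"
    using C_seq_pos[of n k] assms mult_right_mono[of 1 "real n * real (k + 2)" "C_seq n k"]
      mult_mono[of 1 "real n" 1 "real (k + 2)"]
    by (simp add: C_seq_Suc)
  with Suc show ?case by simp
qed

lemma u_tail_2: "u_tail m2 V 2 = 1"
  by (simp add: u_tail.simps)

text \<open>The four terms of the minimum serve different ends: monotonicity; earlier entries stay
  above the threshold of \<open>u 2, \<dots>, u k\<close> followed by all \<open>v j\<close>;
  \<open>u k\<close> itself does not exceed that threshold; and DTA skips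
  \<open>u k\<close>.\<close>

lemma u_tail_le:
  fixes m2 k :: nat and V :: real
  assumes "k \<ge> 3"
  defines "Q \<equiv> (\<Sum>i=2..<k. u_tail m2 V i) + V - 1"
  shows "u_tail m2 V k \<le> u_tail m2 V (k - 1) - 1"
    and "u_tail m2 V k \<le> real (m2 + k - 1) * u_tail m2 V (k - 1) - Q - 1"
    and "u_tail m2 V k \<le> Q / (real (m2 + k - 1) - 1) - 1"
    and "u_tail m2 V k \<le> -1"
  using assms(1) unfolding Q_def by (subst u_tail.simps, simp add: Let_def)+

lemma u_tail_antimono:
  assumes "2 \<le> i" "i \<le> k"
  shows "u_tail m2 V k \<le> u_tail m2 V i"
  using assms(2,1)
proof (induction k rule: dec_induct)
  case (step k)
  then show ?case using u_tail_le(1)[of "Suc k" m2 V] by simp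
qed simp

section \<open>Size estimates for the entries of a fixed instance\<close>

locale worst_case =
  fixes m1 m2 :: nat and \<epsilon> :: real
  assumes m1: "m1 \<ge> 3" and m2: "m2 \<ge> 5" and eps_pos: "0 < \<epsilon>"
    and eps_less: "\<epsilon> < 1 / (2 * real (m1 + m2) * C_seq (m1 + m2) (m2 - 2))"
begin

abbreviation "n \<equiv> m1 + m2"
abbreviation "C \<equiv> C_seq n"
abbreviation "v \<equiv> v_seq m1 m2 \<epsilon>"
abbreviation "V \<equiv> V_sum m1 m2 \<epsilon>"
abbreviation "u \<equiv> u_tail m2 V"
abbreviation "b \<equiv> inst_b m1 m2 \<epsilon>"

lemma C_pos: "k \<ge> 1 \<Longrightarrow> C k > 0"
  using C_seq_pos[of n k] m1 by simp

lemma C_nonneg: "C k \<ge> 0"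
  using C_seq_nonneg[of n k] m1 by simp

text \<open>The constant 8 is the smallest possible \<open>n\<close>, since
  \<open>m1 \<ge> 3\<close> and \<open>m2 \<ge> 5\<close>.\<close>

lemma C_growth:
  assumes "1 \<le> j" "j < k"
  shows "8 * real (j + 2) * C j \<le> C k"
proof -
  have "8 * (real (j + 2) * C j) \<le> real n * (real (j + 2) * C j)"
    using m1 m2 C_nonneg[of j] by (intro mult_right_mono) auto
  also have "\<dots> \<le> C k" using C_seq_growth[of n j k] assms m1 unfolding mult.assoc by simp
  finally show ?thesis by (simp only: mult.assoc)
qed

lemma C_mono: "j \<le> k \<Longrightarrow> C j \<le> C k"
proof (cases "j = 0 \<or> j = k")
  case False
  assume "j \<le> k"
  with False have "8 * real (j + 2) * C j \<le> C k" using C_growth[of j k] by simp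
  moreover have "1 * C j \<le> 8 * real (j + 2) * C j" using C_nonneg by (intro mult_right_mono) auto
  ultimately show ?thesis by simp
qed (auto simp: C_nonneg)

text \<open>The condition on \<open>\<epsilon>\<close> says exactly that
  \<open>\<epsilon> * C (m2 - 2) < gap\<close>, so \<open>gap\<close> bounds all perturbations
  \<open>\<epsilon> * C k\<close> that occur in \<open>v\<close>.\<close>

definition gap :: real where
  "gap = 1 / (2 * real n)"

lemma gap_le: "gap \<le> 1 / 16"
  using m1 m2 by (simp add: gap_def field_simps)

lemma m2_gap: "real (m2 + 1) * gap < 1"
  using m1 m2 by (simp add: gap_def field_simps)

lemma gap_pos: "gap > 0"
  using m1 by (simp add: gap_def)

lemma eps_C_max: "\<epsilon> * C (m2 - 2) < gap"
proof -
  have "C (m2 - 2) > 0" using C_pos m2 by simp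
  then have "\<epsilon> * C (m2 - 2) < 1 / (2 * real n * C (m2 - 2)) * C (m2 - 2)"
    using eps_less by (intro mult_strict_right_mono)
  also have "\<dots> = gap" using \<open>C (m2 - 2) > 0\<close> by (simp add: gap_def)
  finally show ?thesis .
qed

lemma eps_C:
  assumes "k \<le> m2 - 2"
  shows "\<epsilon> * C k < gap"
proof -
  have "\<epsilon> * C k \<le> \<epsilon> * C (m2 - 2)" using C_mono[OF assms] eps_pos by (intro mult_left_mono) auto
  then show ?thesis using eps_C_max by simp
qed

lemma v_gt: "1 \<le> j \<Longrightarrow> j \<le> m2 \<Longrightarrow> v j > 3 - gap"
  using eps_C[of "j - 3"] eps_C[of "m2 - 2"] gap_pos unfolding v_seq_def by auto

lemma v_gt': "1 \<le> j \<Longrightarrow> j \<le> m2 \<Longrightarrow> v j > 5 / 2"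
  using v_gt[of j] gap_le by simp

lemma v_1_le: "v 1 \<le> 3"
  using C_nonneg eps_pos by (simp add: v_seq_def)

lemma v_23: "v 2 = 7 / 2" "v 3 = 7 / 2"
  by (simp_all add: v_seq_def)

lemma v_C: "k \<ge> 1 \<Longrightarrow> v (k + 3) = 3 - \<epsilon> * C k"
  by (simp add: v_seq_def)

lemma b_u: "2 \<le> k \<Longrightarrow> k \<le> m1 \<Longrightarrow> b k = u k"
  by (simp add: inst_b_def u_seq_def)

lemma b_v: "1 \<le> j \<Longrightarrow> b (m1 + j) = v j"
  by (simp add: inst_b_def)

lemma b_2: "b 2 = 1"
  using b_u[of 2] m1 by (simp add: u_tail_2)

text \<open>The last two bounds imply, after clearing the denominator, that the threshold of
  \<open>[1..<k]\<close> lies below \<open>b k\<close>, so that NDTA admits every index. The bound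
  \<open>-2\<close> does the same for index 2.\<close>

lemma b_1:
  "b 1 \<le> -2"
  "3 \<le> k \<Longrightarrow> k \<le> m1 \<Longrightarrow> b 1 \<le> real (k - 1) * u k - (\<Sum>i=2..<k. u i)"
  "1 \<le> j \<Longrightarrow> j \<le> m2 \<Longrightarrow>
     b 1 \<le> real (m1 + j - 1) * v j - (\<Sum>i=2..m1. u i) - (\<Sum>l=1..<j. v l)"
proof -
  let ?A = "{-2} \<union> (\<lambda>k. real (k - 1) * u k - (\<Sum>i=2..<k. u i)) ` {3..m1}
    \<union> (\<lambda>j. real (m1 + j - 1) * v j - (\<Sum>i=2..m1. u i) - (\<Sum>l=1..<j. v l)) ` {1..m2}"
  have b1: "b 1 = Min ?A"
    using m1 unfolding inst_b_def u_seq_def Let_def by (simp only: if_True refl) simp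
  have le: "x \<in> ?A \<Longrightarrow> b 1 \<le> x" for x
    unfolding b1 by (rule Min_le) simp_all
  show "b 1 \<le> -2" by (rule le) blast
  show "b 1 \<le> real (k - 1) * u k - (\<Sum>i=2..<k. u i)" if "3 \<le> k" "k \<le> m1"
    by (rule le) (use that in \<open>simp only: Un_iff, force\<close>)
  show "b 1 \<le> real (m1 + j - 1) * v j - (\<Sum>i=2..m1. u i) - (\<Sum>l=1..<j. v l)" if "1 \<le> j" "j \<le> m2"
    by (rule le, rule UnI2, rule image_eqI[of _ _ j]) (use that in auto)
qed

lemma excess_1: "excess n inst_w b (inst_c m1 m2 \<epsilon>) = 1"
proof -
  have "(\<Sum>i=1..n. b i) = (\<Sum>i=1..m1. b i) + (\<Sum>i=m1+1..m1+m2. b i)"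
    using sum.ub_add_nat[of 1 m1 b m2] by simp
  also have "(\<Sum>i=1..m1. b i) = (\<Sum>i=1..m1. u_seq m1 m2 \<epsilon> i)"
    by (intro sum.cong) (auto simp: inst_b_def)
  also have "(\<Sum>i=m1+1..m1+m2. b i) = (\<Sum>j=1..m2. v j)"
    using sum.shift_bounds_cl_nat_ivl[of b 1 m1 m2] by (simp add: add.commute inst_b_def)
  finally show ?thesis by (simp add: excess_def inst_w_def inst_c_def)
qed

lemma init_canonical: "init n inst_w b 1 = canonical b [1] (2 * n + 4)"
  by (simp add: init_def canonical_def inst_w_def threshold_def)

lemma sum_v_shift: "(\<Sum>i=m1+p..<m1+q. b i) = (\<Sum>j=p..<q. v j)" if "1 \<le> p"
  using sum.shift_bounds_nat_ivl[of b p m1 q] that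
  by (simp add: add.commute inst_b_def)

section \<open>Removal of the second block\<close>

text \<open>\<open>tail k\<close> holds the indices of the entries \<open>7/2, 7/2, 3 - \<epsilon> * C 1, \<dots>, 3 - \<epsilon> * C k\<close>.\<close>

definition tail :: "nat \<Rightarrow> nat list" where
  "tail k = [m1+2..<m1+k+4]"

definition block :: "nat list" where
  "block = [m1+1..<n+1]"

lemma tail_Suc: "tail (Suc k) = tail k @ [m1 + k + 4]"
proof -
  have "m1 + Suc k + 4 = Suc (m1 + k + 4)" by simp
  then show ?thesis unfolding tail_def by (simp only: upt_Suc) simp
qed

lemma tail_0: "tail 0 = [m1 + 2, m1 + 3]"
  by (simp add: tail_def upt_rec)

lemma block_Cons: "block = (m1 + 1) # tail (m2 - 3)"
  using m2 by (simp add: block_def tail_def upt_conv_Cons)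

lemma block_nonempty: "block \<noteq> []"
  by (simp add: block_Cons)

lemma length_block: "length block = m2"
  by (simp add: block_def)

lemma length_tail: "length (tail k) = k + 2"
  by (simp add: tail_def)

lemma tail_nonempty: "tail k \<noteq> []"
  by (simp add: tail_def)

lemma b_v_Suc: "b (Suc m1) = 3 - \<epsilon> * C (m2 - 2)"
  using b_v[of 1] by (simp add: v_seq_def)

lemma b_v_23: "b (m1 + 2) = 7 / 2" "b (m1 + 3) = 7 / 2"
  using b_v[of 2] b_v[of 3] v_23 by simp_all

lemma b_v_C: "b (m1 + k + 4) = 3 - \<epsilon> * C (Suc k)"
  using b_v[of "k + 4"] v_C[of "Suc k"] by (simp add: ac_simps)

lemma sum_tail: "sum_list (map b (tail k)) = 7 + 3 * real k - \<epsilon> * (\<Sum>i=1..k. C i)"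
proof (induction k)
  case 0
  then show ?case using b_v_23 by (simp add: tail_0)
next
  case (Suc k)
  then show ?case using b_v_C[of k] by (simp add: tail_Suc algebra_simps)
qed

lemma sum_C_le: "(\<Sum>i=1..k. C i) \<le> real k * C k"
  using sum_bounded_above[of "{1..k}" C "C k"] C_mono by simp

lemma sum_C_pos: "k \<ge> 1 \<Longrightarrow> (\<Sum>i=1..k. C i) > 0"
  using C_pos by (intro sum_pos) auto

text \<open>The two entries \<open>7/2\<close> make up for the excess 1, so the threshold is 3 minus
  \<open>\<epsilon> * (\<Sum>i=1..k. C i) / (k + 2)\<close>. Hence
  \<open>3 - \<epsilon> * C l\<close> is above it iff \<open>(k + 2) * C l\<close> is less than that
  sum. For \<open>l < k\<close> the term \<open>C k\<close> alone is large enough; for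
  \<open>l = k\<close> the sum is at most \<open>k * C k\<close>.\<close>

lemma fold_tail:
  assumes "1 \<le> k"
  shows "fold (removal_visit inst_w b) (tail k) (canonical b (tail k) t)
           = canonical b (tail (k - 1)) (t + 2 * (k + 2) + 6)"
proof -
  obtain k' where k: "k = Suc k'" using assms by (cases k) auto
  have split: "tail k = tail k' @ [m1 + k' + 4]"
    by (simp add: tail_Suc k)
  have "b i > threshold b (tail k)" if i: "i \<in> set (tail k')" for i
  proof -
    define j where "j = i - m1"
    have j: "i = m1 + j" "2 \<le> j" "j < k' + 4" using i by (auto simp: tail_def j_def)
    have pos: "\<epsilon> * (\<Sum>i=1..k. C i) > 0" using eps_pos sum_C_pos[of k] assms by simp
    show ?thesis
    proof (cases "j \<le> 3")
      case True
      then have "b i = 7 / 2" using j b_v_23 by (cases "j = 2") (auto simp: le_Suc_eq numeral_eq_Suc)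
      show ?thesis
        unfolding threshold_less_iff[OF tail_nonempty] sum_tail length_tail \<open>b i = 7 / 2\<close>
        using pos by (simp add: algebra_simps)
    next
      case False
      define l where "l = j - 3"
      have l: "j = l + 3" "1 \<le> l" "l < k" using False j by (auto simp: l_def k)
      have bi: "b i = 3 - \<epsilon> * C l" using j l b_v[of j] v_C[of l] by simp
      have "real (k + 2) * C l \<le> real (k + 2) * C k'"
        using C_mono[of l k'] l k by (intro mult_left_mono) auto
      \<comment> \<open>Here \<open>k + 2 = k' + 3\<close>, so the factor 8 absorbs the shift of the
        index.\<close>
      also have "\<dots> < 8 * real (k' + 2) * C k'"
        using C_pos[of k'] l k by (intro mult_strict_right_mono) auto
      also have "\<dots> \<le> C k" using C_growth[of k' k] l k by simp
      also have "\<dots> \<le> (\<Sum>i=1..k. C i)"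
        using member_le_sum[of k "{1..k}" C] C_nonneg assms by simp
      finally have "\<epsilon> * (real (k + 2) * C l) < \<epsilon> * (\<Sum>i=1..k. C i)"
        using eps_pos by simp
      then show ?thesis unfolding threshold_less_iff[OF tail_nonempty] sum_tail length_tail bi
        by (simp add: algebra_simps)
    qed
  qed
  moreover have "b (m1 + k' + 4) \<le> threshold b (tail k)"
  proof -
    have "(\<Sum>i=1..k. C i) \<le> real (k + 2) * C k"
      using sum_C_le[of k] C_nonneg[of k] by (simp add: algebra_simps)
    then have "\<epsilon> * (\<Sum>i=1..k. C i) \<le> \<epsilon> * (real (k + 2) * C k)"
      using eps_pos by simp
    moreover have bk: "b (m1 + k' + 4) = 3 - \<epsilon> * C k"
      by (simp only: b_v_C k)
    ultimately show ?thesis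
      unfolding le_threshold_iff[OF tail_nonempty] sum_tail length_tail bk
      by (simp add: algebra_simps)
  qed
  \<comment> \<open>The removed index is the last one visited, so the raised threshold is not tested
    in this pass.\<close>
  ultimately show ?thesis
    using removal_fold_single[of "tail k'" "m1 + k' + 4" "[]" b t] tail_nonempty[of k'] split
    by (simp add: length_tail k) (simp add: tail_def)
qed

text \<open>The threshold is 3 minus the average of the \<open>m2\<close> perturbations, two of
  which are zero after the entries \<open>7/2\<close> have paid for the excess. The entry
  \<open>v 1\<close> has the largest perturbation and so cannot exceed it.\<close>

lemma threshold_block:
  "b (m1 + 1) \<le> threshold b block" "threshold b block < 3" "5 / 2 < threshold b block"
proof -
  let ?\<Sigma> = "C (m2 - 2) + (\<Sum>i=1..m2-3. C i)"
  note ne = block_nonempty and len = length_block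
  have v1: "b (m1 + 1) = 3 - \<epsilon> * C (m2 - 2)" using b_v_Suc by simp
  have s: "sum_list (map b block) = 3 * real m2 + 1 - \<epsilon> * ?\<Sigma>"
    using m2 by (simp add: block_Cons sum_tail b_v_Suc algebra_simps)
  have "(\<Sum>i=1..m2-3. C i) \<le> real (m2 - 3) * C (m2 - 3)" by (rule sum_C_le)
  also have "\<dots> \<le> real (m2 - 3) * C (m2 - 2)"
    using C_mono[of "m2 - 3" "m2 - 2"] by (intro mult_left_mono) auto
  finally have "?\<Sigma> \<le> real (m2 - 2) * C (m2 - 2)"
    using m2 by (simp add: algebra_simps of_nat_diff)
  also have "\<dots> \<le> real m2 * C (m2 - 2)" using C_nonneg by (intro mult_right_mono) auto
  finally have le: "\<epsilon> * ?\<Sigma> \<le> \<epsilon> * (real m2 * C (m2 - 2))" using eps_pos by simp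
  then show "b (m1 + 1) \<le> threshold b block"
    unfolding le_threshold_iff[OF ne] s len v1 by (simp add: algebra_simps)
  have "?\<Sigma> > 0" using m2 by (intro add_pos_pos C_pos sum_C_pos) auto
  then have "\<epsilon> * ?\<Sigma> > 0" using eps_pos by simp
  then show "threshold b block < 3"
    unfolding threshold_less_iff[OF ne] s len by simp
  note le
  also have "\<epsilon> * (real m2 * C (m2 - 2)) = real m2 * (\<epsilon> * C (m2 - 2))" by simp
  also have "\<dots> \<le> real m2 * (1 / 16)"
    using eps_C_max gap_le by (intro mult_left_mono) auto
  finally show "5 / 2 < threshold b block"
    unfolding less_threshold_iff[OF ne] s len using m2 by simp
qed

text \<open>Two removals share this pass: once \<open>m1 + 1\<close> is gone, the remaining visits
  form a full pass over \<open>tail (m2 - 3)\<close>, which drops its last index as well.\<close>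

lemma fold_block:
  "fold (removal_visit inst_w b) block (canonical b block t)
     = canonical b (tail (m2 - 4)) (t + 8 + 2 * (m2 - 1) + 6)"
proof -
  have "removeAll (m1 + 1) block = tail (m2 - 3)"
    by (simp add: block_Cons tail_def)
  then have "removal_visit inst_w b (m1 + 1) (canonical b block t)
      = canonical b (tail (m2 - 3)) (t + 8)"
    using removal_visit_canonical_remove[of block "m1 + 1" b t] threshold_block(1) m2
    by (simp add: block_def)
  then have "fold (removal_visit inst_w b) block (canonical b block t)
      = fold (removal_visit inst_w b) (tail (m2 - 3)) (canonical b (tail (m2 - 3)) (t + 8))"
    by (metis block_Cons fold_simps(2))
  also have "\<dots> = canonical b (tail (m2 - 4)) (t + 8 + 2 * (m2 - 1) + 6)"
  proof -
    have "m2 - 3 - 1 = m2 - 4" "t + 8 + 2 * (m2 - 3 + 2) + 6 = t + 8 + 2 * (m2 - 1) + 6"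
      using m2 by simp_all
    then show ?thesis using fold_tail[of "m2 - 3" "t + 8"] m2 by simp
  qed
  finally show ?thesis .
qed

abbreviation loop_time :: "nat list \<Rightarrow> nat \<Rightarrow> nat" where
  "loop_time S t \<equiv> snd (snd (snd (removal_loop inst_w b (canonical b S t))))"

lemma loop_time_ge: "t \<le> loop_time S t"
  using removal_loop_time_ge[of "canonical b S t" inst_w b] by (simp add: canonical_def)

text \<open>A pass over \<open>tail (Suc k)\<close> costs more than \<open>2 * k + 1\<close>, the
  difference of consecutive squares.\<close>

lemma loop_time_tail: "t + k ^ 2 \<le> loop_time (tail k) t"
proof (induction k arbitrary: t)
  case 0
  then show ?case using loop_time_ge by simp
next
  case (Suc k)
  have "loop_time (tail (Suc k)) t = loop_time (tail k) (t + 2 * (Suc k + 2) + 6 + 1)"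
    using removal_loop_canonical_pass[OF fold_tail[of "Suc k" t]] by (simp add: length_tail)
  with Suc[of "t + 2 * (Suc k + 2) + 6 + 1"] show ?case by (simp add: power2_eq_square)
qed

lemma loop_time_block: "t + (m2 - 4) ^ 2 \<le> loop_time block t"
proof -
  have "loop_time block t = loop_time (tail (m2 - 4)) (t + 8 + 2 * (m2 - 1) + 6 + 1)"
    using m2 by (intro removal_loop_canonical_pass[OF fold_block]) (simp add: length_tail block_def)
  then show ?thesis using loop_time_tail[of "t + 8 + 2 * (m2 - 1) + 6 + 1" "m2 - 4"] by simp
qed

section \<open>Removal of the first block\<close>

text \<open>What NDTA still holds once index 1 and the indices \<open>k + 1, \<dots>, m1\<close>
  have been removed.\<close>

definition initial_part :: "nat \<Rightarrow> nat list" where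
  "initial_part k = [2..<k+1] @ block"

lemma sum_block: "sum_list (map b block) = V"
  using sum_v_shift[of 1 "m2 + 1"]
  by (simp add: block_def V_sum_def interv_sum_list_conv_sum_set_nat atLeastLessThanSuc_atLeastAtMost
      del: sum.op_ivl_Suc upt_Suc)

text \<open>The threshold of \<open>block\<close> is \<open>(V - 1) / m2\<close>; it lies below 3
  and is at least \<open>v 1 > 3 - gap\<close>.\<close>

lemma V_bounds: "3 * real m2 \<le> V" "V \<le> 3 * real m2 + 1"
proof -
  note ne = block_nonempty and len = length_block
  show "V \<le> 3 * real m2 + 1"
    using threshold_block(2) unfolding threshold_less_iff[OF ne] len sum_block by simp
  have "real m2 * (3 - gap) \<le> real m2 * b (m1 + 1)"
    using v_gt[of 1] b_v[of 1] m2 by (intro mult_left_mono) auto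
  also have "\<dots> \<le> V - 1"
    using threshold_block(1) unfolding le_threshold_iff[OF ne] len sum_block by simp
  also have "real m2 * (3 - gap) \<ge> 3 * real m2 - 1"
    using m2_gap gap_pos by (simp add: algebra_simps)
  finally show "3 * real m2 \<le> V" by simp
qed

lemma sum_initial_part:
  "k \<le> m1 \<Longrightarrow> sum_list (map b (initial_part k)) = (\<Sum>i=2..<k+1. u i) + V"
  using sum.cong[of "{2..<k+1}" "{2..<k+1}" b u] b_u
  by (simp add: initial_part_def sum_block interv_sum_list_conv_sum_set_nat del: sum.op_ivl_Suc upt_Suc)

lemma length_initial_part: "k \<ge> 2 \<Longrightarrow> length (initial_part k) = m2 + k - 1"
  by (simp add: initial_part_def block_def del: upt_Suc)

lemma initial_part_nonempty: "initial_part k \<noteq> []"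
  by (simp add: initial_part_def block_Cons)

lemma threshold_initial_part_less:
  assumes "3 \<le> k" "k \<le> m1"
  shows "threshold b (initial_part k) < u (k - 1)"
proof -
  have "(\<Sum>i=2..<k+1. u i) = (\<Sum>i=2..<k. u i) + u k" using assms by simp
  then show ?thesis
    using u_tail_le(2)[of k m2 V] assms
    unfolding threshold_less_iff[OF initial_part_nonempty]
    by (simp add: sum_initial_part length_initial_part del: sum.op_ivl_Suc)
qed

lemma threshold_initial_part_ge:
  assumes "3 \<le> k" "k \<le> m1"
  shows "b k \<le> threshold b (initial_part k)"
proof -
  define q where "q = real (m2 + k - 1)"
  define Q where "Q = (\<Sum>i=2..<k. u i) + V - 1"
  have q: "q > 1" using assms m2 by (simp add: q_def)
  have "u k \<le> Q / (q - 1)"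
    using u_tail_le(3)[of k m2 V] assms by (simp add: q_def Q_def)
  then have "u k * (q - 1) \<le> Q" using q by (simp add: pos_le_divide_eq)
  moreover have "(\<Sum>i=2..<k+1. u i) = (\<Sum>i=2..<k. u i) + u k" using assms by simp
  ultimately show ?thesis
    using assms unfolding le_threshold_iff[OF initial_part_nonempty]
    by (simp add: sum_initial_part length_initial_part b_u q_def Q_def algebra_simps
        del: sum.op_ivl_Suc)
qed

text \<open>As \<open>u 2 = 1\<close> cancels the excess, the threshold is
  \<open>V / (m2 + 1)\<close>.\<close>

lemma threshold_initial_part_2:
  "b 2 \<le> threshold b (initial_part 2)" "threshold b (initial_part 2) < 3 - gap"
proof -
  have singleton: "{2..<3::nat} = {2}" by auto
  have s: "sum_list (map b (initial_part 2)) = 1 + V" and l: "length (initial_part 2) = m2 + 1"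
    using sum_initial_part[of 2] length_initial_part[of 2] m1 singleton
    by (simp_all add: u_tail_2)
  show "b 2 \<le> threshold b (initial_part 2)"
    unfolding le_threshold_iff[OF initial_part_nonempty] s l b_2 using V_bounds m2 by simp
  show "threshold b (initial_part 2) < 3 - gap"
    unfolding threshold_less_iff[OF initial_part_nonempty] s l
    using V_bounds m2_gap by (simp add: algebra_simps)
qed

lemma threshold_initial_part_less_v:
  assumes "2 \<le> k" "k \<le> m1" "i \<in> set block"
  shows "threshold b (initial_part k) < b i"
proof -
  define j where "j = i - m1"
  have j: "i = m1 + j" "1 \<le> j" "j \<le> m2" using assms(3) by (auto simp: block_def j_def)
  have bi: "b i > 3 - gap" using v_gt[of j] b_v[of j] j by simp
  show ?thesis
  proof (cases "k = 2")
    case True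
    then show ?thesis using threshold_initial_part_2 bi by simp
  next
    case False
    then have "threshold b (initial_part k) < u (k - 1)"
      using threshold_initial_part_less assms by simp
    also have "\<dots> \<le> u 2" using u_tail_antimono[of 2 "k - 1"] assms False by simp
    finally show ?thesis using bi gap_le by (simp add: u_tail_2)
  qed
qed

lemma fold_initial_part:
  assumes "3 \<le> k" "k \<le> m1"
  shows "fold (removal_visit inst_w b) (initial_part k) (canonical b (initial_part k) t)
           = canonical b (initial_part (k - 1)) (t + 2 * (m2 + k - 1) + 6)"
proof -
  have split: "initial_part k = [2..<k] @ k # block" and split': "initial_part (k - 1) = [2..<k] @ block"
    using assms by (simp_all add: initial_part_def)
  have "\<forall>i\<in>set [2..<k]. threshold b (initial_part k) < b i"
  proof
    fix i assume "i \<in> set [2..<k]"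
    moreover from this have "i \<le> k - 1" by auto
    ultimately show "threshold b (initial_part k) < b i"
      using threshold_initial_part_less[OF assms] u_tail_antimono[of i "k - 1" m2 V] b_u[of i] assms
      by simp
  qed
  \<comment> \<open>The indices of \<open>block\<close> are visited after \<open>k\<close> and so
    meet the threshold of the shorter list.\<close>
  moreover have "\<forall>i\<in>set block. threshold b (initial_part (k - 1)) < b i"
    using threshold_initial_part_less_v[of "k - 1"] assms by simp
  moreover have "distinct ([2..<k] @ k # block)" using assms by (auto simp: block_def)
  ultimately show ?thesis
    using removal_fold_single[of "[2..<k]" k block b t] threshold_initial_part_ge[OF assms]
      length_initial_part[of k] assms block_nonempty
    unfolding split split' by simp
qed

text \<open>Three removals happen in this pass: index 2 and the two of
  \<open>fold_block\<close>.\<close>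

lemma fold_initial_part_2:
  "fold (removal_visit inst_w b) (initial_part 2) (canonical b (initial_part 2) t)
     = canonical b (tail (m2 - 4)) (t + 8 + 8 + 2 * (m2 - 1) + 6)"
proof -
  have split: "initial_part 2 = 2 # block" by (simp add: initial_part_def)
  have "removal_visit inst_w b 2 (canonical b (initial_part 2) t) = canonical b block (t + 8)"
    using removal_visit_canonical_remove[of "initial_part 2" 2 b t] threshold_initial_part_2(1)
      length_initial_part[of 2] m1 m2
    by (simp add: split) (simp add: block_def)
  then show ?thesis using fold_block[of "t + 8"] by (metis split fold_simps(2))
qed

lemma loop_time_initial_part:
  assumes "2 \<le> k" "k \<le> m1"
  shows "t + (k - 2) ^ 2 + (m2 - 4) ^ 2 \<le> loop_time (initial_part k) t"
  using assms
proof (induction k arbitrary: t rule: nat_induct_at_least)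
  case base
  have "loop_time (initial_part 2) t = loop_time (tail (m2 - 4)) (t + 8 + 8 + 2 * (m2 - 1) + 6 + 1)"
    using length_initial_part[of 2] m2
    by (intro removal_loop_canonical_pass[OF fold_initial_part_2]) (simp add: length_tail)
  then show ?case using loop_time_tail[of "t + 8 + 8 + 2 * (m2 - 1) + 6 + 1" "m2 - 4"] by simp
next
  case (Suc k)
  let ?t = "t + 2 * (m2 + k) + 6 + 1"
  have "loop_time (initial_part (Suc k)) t = loop_time (initial_part k) ?t"
    using removal_loop_canonical_pass[OF fold_initial_part[of "Suc k" t]] Suc
      length_initial_part[of k] length_initial_part[of "Suc k"] by simp
  moreover have "?t + (k - 2) ^ 2 + (m2 - 4) ^ 2 \<le> loop_time (initial_part k) ?t"
    using Suc by simp
  \<comment> \<open>The pass just made costs at least \<open>2 * k\<close>, which pays for the next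
    square.\<close>
  moreover have "(Suc k - 2) ^ 2 \<le> (k - 2) ^ 2 + 2 * k"
  proof -
    obtain l where "k = l + 2" using Suc by (metis le_add_diff_inverse2)
    then show ?thesis by (simp add: power2_eq_square)
  qed
  ultimately show ?case by simp
qed

section \<open>The running time of NDTA\<close>

lemma sum_prefix: "sum_list (map b [1..<k]) = (\<Sum>i=1..<k. b i)"
  by (simp add: interv_sum_list_conv_sum_set_nat)

lemma threshold_prefix_less:
  assumes "2 \<le> k" "k \<le> n"
  shows "threshold b [1..<k] < b k"
proof -
  have ne: "[1..<k] \<noteq> []" using assms by simp
  have head: "(\<Sum>i=1..<l. b i) = b 1 + (\<Sum>i=2..<l. b i)" if "l \<ge> 2" for l
    using that sum.atLeast_Suc_lessThan[of 1 l b] by (simp add: numeral_2_eq_2)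
  have first: "(\<Sum>i=2..<l. b i) = (\<Sum>i=2..<l. u i)" if "l \<le> m1 + 1" for l
    using that b_u by (intro sum.cong) auto
  \<comment> \<open>The cases correspond to the three groups of terms in the minimum that defines
    \<open>u 1\<close>.\<close>
  consider "k = 2" | "3 \<le> k" "k \<le> m1" | "k > m1" using assms by linarith
  then show ?thesis
  proof cases
    case 1
    then show ?thesis using b_1(1) b_2 by (simp add: threshold_def upt_rec)
  next
    case 2
    then show ?thesis using b_1(2)[of k]
      unfolding threshold_less_iff[OF ne] sum_prefix
      by (simp add: head first b_u del: One_nat_def)
  next
    case 3
    define j where "j = k - m1"
    have j: "k = m1 + j" "1 \<le> j" "j \<le> m2" using 3 assms by (auto simp: j_def)
    have "(\<Sum>i=2..<k. b i) = (\<Sum>i=2..<m1+1. b i) + (\<Sum>i=m1+1..<k. b i)"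
      using j m1 by (subst sum.atLeastLessThan_concat) auto
    also have "\<dots> = (\<Sum>i=2..m1. u i) + (\<Sum>l=1..<j. v l)"
      using first[of "m1 + 1"] sum_v_shift[of 1 j] j
      by (simp add: atLeastLessThanSuc_atLeastAtMost del: sum.op_ivl_Suc)
    finally show ?thesis using b_1(3)[of j] j assms
      unfolding threshold_less_iff[OF ne] sum_prefix
      by (simp add: head b_v del: One_nat_def)
  qed
qed

lemma ndta_scan:
  assumes "2 \<le> k" "k \<le> n + 1"
  shows "fold (add_step inst_w b) [2..<k] (canonical b [1] t) = canonical b [1..<k] (t + 8 * (k - 2))"
  using assms
proof (induction k rule: nat_induct_at_least)
  case base
  then show ?case by (simp add: upt_rec)
next
  case (Suc k)
  moreover have "8 * (k - 2) + 8 = 8 * (Suc k - 2)" using Suc by simp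
  ultimately show ?case
    using threshold_prefix_less[of k] add_step_canonical_less[of "[1..<k]" b k]
    by (simp add: add.assoc)
qed

lemma b_1_le_threshold_prefix:
  assumes "3 \<le> k" "k \<le> n + 1"
  shows "b 1 \<le> threshold b [1..<k]"
  using assms
proof (induction k rule: nat_induct_at_least)
  case base
  then show ?case using b_1(1) b_2 by (simp add: threshold_def upt_rec numeral_2_eq_2)
next
  case (Suc k)
  then show ?case
    using threshold_prefix_less[of k] threshold_mono_append[of "[1..<k]" b k] by simp
qed

text \<open>The first pass removes both index 1 and index \<open>m1\<close>, so the count of squares
  starts from \<open>initial_part (m1 - 1)\<close>; this explains \<open>m1 - 3\<close>.\<close>

lemma loop_time_all: "t + (m1 - 3) ^ 2 + (m2 - 4) ^ 2 \<le> loop_time [1..<n+1] t"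
proof -
  have split: "[1..<n+1] = 1 # initial_part m1"
    using m1 upt_add_eq_append[of 2 "m1 + 1" m2] upt_conv_Cons[of 1 "n + 1"]
    by (simp add: initial_part_def block_def numeral_2_eq_2 del: upt_Suc)
  have "removal_visit inst_w b 1 (canonical b [1..<n+1] t) = canonical b (initial_part m1) (t + 8)"
    using removal_visit_canonical_remove[of "[1..<n+1]" 1 b t] b_1_le_threshold_prefix[of "n + 1"]
      m1 m2 arg_cong[OF split, of "removeAll 1"]
    by (simp add: initial_part_def block_def del: upt_Suc)
  then have "fold (removal_visit inst_w b) [1..<n+1] (canonical b [1..<n+1] t)
      = fold (removal_visit inst_w b) (initial_part m1) (canonical b (initial_part m1) (t + 8))"
    by (metis split fold_simps(2))
  also have "\<dots> = canonical b (initial_part (m1 - 1)) (t + 8 + 2 * (m2 + m1 - 1) + 6)"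
    using fold_initial_part[of m1 "t + 8"] m1 by simp
  finally have "loop_time [1..<n+1] t
      = loop_time (initial_part (m1 - 1)) (t + 8 + 2 * (m2 + m1 - 1) + 6 + 1)"
    using m1 length_initial_part[of "m1 - 1"] by (intro removal_loop_canonical_pass) auto
  moreover have m: "2 \<le> m1 - 1" "m1 - 1 \<le> m1" "m1 - 1 - 2 = m1 - 3" using m1 by simp_all
  ultimately show ?thesis
    using loop_time_initial_part[OF m(1,2), of "t + 8 + 2 * (m2 + m1 - 1) + 6 + 1"]
    unfolding m(3) by linarith
qed

lemma result_time:
  "snd (snd (snd st)) + n \<le> snd (result n b st)"
  "snd (result n b st) \<le> snd (snd (snd st)) + n + length (fst st)"
  by (cases st; simp)+

lemma loop_time_le: "loop_time S t \<le> t + (length S + 1) * (8 * length S + 1)"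
  using removal_loop_time_le[of inst_w b "canonical b S t"] by (simp add: canonical_def)

lemma loop_length_le: "length (fst (removal_loop inst_w b (canonical b S t))) \<le> length S"
  using removal_loop_length[of inst_w b "canonical b S t"] by (simp add: canonical_def)

lemma ndta_time_eq:
  "ndta_time n inst_w b (inst_c m1 m2 \<epsilon>)
     = snd (result n b (removal_loop inst_w b (canonical b [1..<n+1] (10 * n - 4))))"
proof -
  have "2 * n + 4 + 8 * (n + 1 - 2) = 10 * n - 4" using m1 by simp
  then have "fold (add_step inst_w b) [2..<n+1] (init n inst_w b 1) = canonical b [1..<n+1] (10 * n - 4)"
    using ndta_scan[of "n + 1" "2 * n + 4"] m1 unfolding init_canonical by (simp del: upt_Suc)
  then show ?thesis unfolding ndta_time_def ndta_def excess_1 Let_def by simp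
qed

lemma ndta_time_lower:
  "(real m1 + real m2) ^ 2 \<le> 2 * T_ndta (m1, m2, \<epsilon>)"
proof -
  have "10 * n - 4 + (m1 - 3) ^ 2 + (m2 - 4) ^ 2 + n \<le> ndta_time n inst_w b (inst_c m1 m2 \<epsilon>)"
    unfolding ndta_time_eq
    using loop_time_all[of "10 * n - 4"] result_time(1)
    by (meson add_le_mono le_refl le_trans)
  then have "real (10 * n - 4 + (m1 - 3) ^ 2 + (m2 - 4) ^ 2 + n) \<le> T_ndta (m1, m2, \<epsilon>)"
    unfolding T_ndta_def by (simp only: prod.case of_nat_le_iff)
  moreover have "real (10 * n - 4 + (m1 - 3) ^ 2 + (m2 - 4) ^ 2 + n)
      = 11 * (real m1 + real m2) - 4 + (real m1 - 3) ^ 2 + (real m2 - 4) ^ 2"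
    using m1 m2 by (simp add: of_nat_diff)
  moreover have "(real m1 + real m2) ^ 2 \<le> 2 * (real m1 ^ 2 + real m2 ^ 2)"
    using sum_squares_bound[of "real m1" "real m2"] by (simp add: power2_sum)
  \<comment> \<open>The linear cost \<open>11 * n\<close> absorbs the terms \<open>-6 * m1\<close>
    and \<open>-8 * m2\<close> of the two squares.\<close>
  ultimately show ?thesis using m1 m2 by (simp add: power2_diff)
qed

lemma ndta_time_upper: "T_ndta (m1, m2, \<epsilon>) \<le> 30 * (real m1 + real m2) ^ 2"
proof -
  have "ndta_time n inst_w b (inst_c m1 m2 \<epsilon>) \<le> 10 * n - 4 + (n + 1) * (8 * n + 1) + n + n"
    unfolding ndta_time_eq
    using loop_time_le[of "[1..<n+1]" "10 * n - 4"] loop_length_le[of "[1..<n+1]" "10 * n - 4"]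
      result_time(2)[of "removal_loop inst_w b (canonical b [1..<n+1] (10 * n - 4))"]
    by (simp del: upt_Suc)
  also have "\<dots> \<le> 8 * n ^ 2 + 21 * n + 1" by (simp add: power2_eq_square algebra_simps)
  \<comment> \<open>For \<open>n \<ge> 1\<close> each term is at most its coefficient times
    \<open>n ^ 2\<close>, and 8 + 21 + 1 = 30.\<close>
  also have "\<dots> \<le> 30 * n ^ 2"
  proof -
    have "8 * x ^ 2 + 21 * x + 1 \<le> 30 * x ^ 2" if "x \<ge> 1" for x :: nat
      using that by (cases x) (auto simp: power2_eq_square)
    from this[of n] show ?thesis using m1 by simp
  qed
  finally have "real (ndta_time n inst_w b (inst_c m1 m2 \<epsilon>)) \<le> real (30 * n ^ 2)"
    by (rule of_nat_mono)
  then show ?thesis by (simp add: T_ndta_def)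
qed

section \<open>The running time of DTA\<close>

text \<open>Index 2 causes a reset because the threshold of \<open>[1, 2]\<close> is negative while
  \<open>b 2 - 1 = 0\<close>. The threshold is then 0, and all later \<open>u k\<close> are at most
  -1. The 12 includes the move of index 1 into \<open>J\<close>.\<close>

lemma dta_scan_first_block:
  assumes "3 \<le> k" "k \<le> m1 + 1"
  shows "fold (dta_scan inst_w b 1) [2..<k] ([], canonical b [1] t)
           = ([1], canonical b [2] (t + 12 + 2 * (k - 3)))"
  using assms
proof (induction k rule: nat_induct_at_least)
  case base
  have "dta_scan inst_w b 1 2 ([], canonical b [1] t) = ([1], canonical b [2] (t + 12))"
    using dta_scan_canonical_reset[of "[1]" b 2 "[]" t] b_1(1) b_2 by (simp add: threshold_def add.commute)
  then show ?case by (simp add: upt_rec)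
next
  case (Suc k)
  have "b k \<le> threshold b [2]"
    using Suc u_tail_le(4)[of k m2 V] b_u[of k] b_2 by (simp add: threshold_def)
  then have "dta_scan inst_w b 1 k (J, canonical b [2] t') = (J, canonical b [2] (t' + 2))" for J t'
    by (rule dta_scan_canonical_skip)
  with Suc show ?case by (simp add: Suc_diff_le)
qed

lemma sum_second_prefix:
  "sum_list (map b [m1+1..<m1+k+4])
     = 10 + 3 * real k - \<epsilon> * (C (m2 - 2) + (\<Sum>i=1..k. C i))"
proof -
  have "[m1+1..<m1+k+4] = (m1 + 1) # tail k" by (simp add: tail_def upt_conv_Cons)
  then show ?thesis by (simp add: sum_tail b_v_Suc algebra_simps)
qed

text \<open>At \<open>v 1\<close> the tentative threshold \<open>v 1 / 2\<close> is at most
  \<open>v 1 - 1\<close>, which forces a reset. Afterwards the large perturbation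
  \<open>\<epsilon> * C (m2 - 2)\<close> of \<open>v 1\<close> holds the threshold below every later
  \<open>v j\<close>, so all of them are added.\<close>

lemma dta_scan_second_block:
  assumes "k \<le> m2 - 3"
  shows "fold (dta_scan inst_w b 1) [m1+1..<m1+k+4] ([1], canonical b [2] t)
           = ([1, 2], canonical b [m1+1..<m1+k+4] (t + 34 + 11 * k))"
  using assms
proof (induction k)
  case 0
  have v1: "b (m1 + 1) = v 1" "5 / 2 < v 1" "v 1 \<le> 3"
    using b_v[of 1] v_gt'[of 1] v_1_le m2 by simp_all
  have 1: "dta_scan inst_w b 1 (m1 + 1) ([1], canonical b [2] t)
      = ([1, 2], canonical b [m1 + 1] (t + 12))"
    using dta_scan_canonical_reset[of "[2]" b "m1 + 1" "[1]" t] v1 b_2 by (simp add: threshold_def add.commute)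
  have 2: "dta_scan inst_w b 1 (m1 + 2) ([1, 2], canonical b [m1 + 1] (t + 12))
      = ([1, 2], canonical b [m1 + 1, m1 + 2] (t + 23))"
    using dta_scan_canonical_add[of "[m1 + 1]" b "m1 + 2" "[1, 2]" "t + 12"] v1 b_v_23
    by (simp add: threshold_def)
  have 3: "dta_scan inst_w b 1 (m1 + 3) ([1, 2], canonical b [m1 + 1, m1 + 2] (t + 23))
      = ([1, 2], canonical b [m1 + 1, m1 + 2, m1 + 3] (t + 34))"
    using dta_scan_canonical_add[of "[m1 + 1, m1 + 2]" b "m1 + 3" "[1, 2]" "t + 23"] v1 b_v_23
    by (simp add: threshold_def)
  have "[m1+1..<m1+0+4] = [m1 + 1, m1 + 2, m1 + 3]"
    by (simp add: upt_rec)
  then show ?case using 1 2 3 by simp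
next
  case (Suc k)
  let ?S = "[m1+1..<m1+k+4]" and ?i = "m1 + k + 4"
  have ne: "?S \<noteq> []" by simp
  have len: "length ?S = k + 3" by simp
  have ne': "?S @ [?i] \<noteq> []" by simp
  have bi: "b ?i = 3 - \<epsilon> * C (Suc k)"
    by (rule b_v_C)
  have lt: "threshold b ?S < b ?i"
  proof -
    have "real (k + 3) * C (Suc k) < 8 * real (Suc k + 2) * C (Suc k)"
      using C_pos[of "Suc k"] by (intro mult_strict_right_mono) auto
    also have "\<dots> \<le> C (m2 - 2)" using C_growth[of "Suc k" "m2 - 2"] Suc by simp
    also have "\<dots> \<le> C (m2 - 2) + (\<Sum>i=1..k. C i)"
      using sum_nonneg[of "{1..k}" C] C_nonneg by simp
    finally have "\<epsilon> * (real (k + 3) * C (Suc k)) < \<epsilon> * (C (m2 - 2) + (\<Sum>i=1..k. C i))"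
      using eps_pos by simp
    then show ?thesis
      unfolding threshold_less_iff[OF ne] sum_second_prefix bi len by (simp add: algebra_simps)
  qed
  \<comment> \<open>No reset occurs: all perturbations are below 1, so already the old, lower
    threshold exceeds \<open>b ?i - 1\<close>.\<close>
  have "b ?i - 1 < threshold b ?S"
  proof -
    have "(\<Sum>i=1..k. C i) \<le> real k * C k" by (rule sum_C_le)
    also have "\<dots> \<le> real k * C (m2 - 2)" using C_mono[of k "m2 - 2"] Suc by (intro mult_left_mono) auto
    finally have "C (m2 - 2) + (\<Sum>i=1..k. C i) \<le> real (k + 3) * C (m2 - 2)"
      using C_nonneg[of "m2 - 2"] by (simp add: algebra_simps)
    then have "\<epsilon> * (C (m2 - 2) + (\<Sum>i=1..k. C i)) \<le> \<epsilon> * (real (k + 3) * C (m2 - 2))"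
      using eps_pos by simp
    also have "\<dots> = real (k + 3) * (\<epsilon> * C (m2 - 2))" by simp
    also have "\<dots> < real (k + 3) * 1"
      using eps_C_max gap_le by (intro mult_strict_left_mono) auto
    finally have "\<epsilon> * (C (m2 - 2) + (\<Sum>i=1..k. C i)) < real (k + 3)" by simp
    moreover have "0 \<le> real (k + 3) * (\<epsilon> * C (Suc k))" using eps_pos C_nonneg by simp
    ultimately show ?thesis
      unfolding less_threshold_iff[OF ne] sum_second_prefix bi len by (simp add: algebra_simps)
  qed
  also have "\<dots> < threshold b (?S @ [?i])" by (rule threshold_mono_append[OF ne lt])
  finally have "dta_scan inst_w b 1 ?i ([1, 2], canonical b ?S (t + 34 + 11 * k))
      = ([1, 2], canonical b (?S @ [?i]) (t + 34 + 11 * k + 11))"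
    by (rule dta_scan_canonical_add[OF ne lt])
  moreover have "[m1+1..<m1+Suc k+4] = ?S @ [?i]"
    using tail_Suc[of k] by (simp add: tail_def upt_conv_Cons)
  ultimately show ?case using Suc by simp
qed

lemma dta_scan_all:
  "fold (dta_scan inst_w b 1) [2..<n+1] ([], canonical b [1] t)
     = ([1, 2], canonical b block (t + 12 + 2 * (m1 - 2) + 34 + 11 * (m2 - 3)))"
proof -
  have "[2..<n+1] = [2..<m1+1] @ block"
    using m1 upt_add_eq_append[of 2 "m1 + 1" m2] by (simp add: block_def)
  moreover have "block = [m1+1..<m1+(m2-3)+4]" using m2 by (simp add: block_def)
  ultimately show ?thesis
    using dta_scan_first_block[of "m1 + 1" t] dta_scan_second_block[of "m2 - 3"] m1
    by (simp del: upt_Suc)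
qed

lemma dta_time_eq:
  "dta_time n inst_w b (inst_c m1 m2 \<epsilon>)
     = snd (result n b (removal_loop inst_w b (canonical b block (2 * n + 2 * m1 + 11 * m2 + 18))))"
proof -
  \<comment> \<open>Neither index of \<open>J\<close> is readmitted; each costs only a visit and a
    comparison, hence the 4 below.\<close>
  have "b 1 \<le> threshold b block" "b 2 \<le> threshold b block"
    using threshold_block(3) b_1(1) b_2 by simp_all
  then have J: "fold (add_step inst_w b) [1, 2] (block, real (length block), threshold b block, t)
      = (block, real (length block), threshold b block, t + 4)" for t
    by simp
  have t: "2 * n + 4 + 12 + 2 * (m1 - 2) + 34 + 11 * (m2 - 3) + 1 + 4 = 2 * n + 2 * m1 + 11 * m2 + 18"
    using m1 m2 by simp
  show ?thesis
    unfolding dta_time_def dta_def excess_1 Let_def init_canonical dta_scan_all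
    unfolding canonical_def prod.case J t ..
qed

lemma dta_time_lower: "real m1 + real m2 ^ 2 \<le> T_dta (m1, m2, \<epsilon>)"
proof -
  let ?t = "2 * n + 2 * m1 + 11 * m2 + 18"
  have "?t + (m2 - 4) ^ 2 + n \<le> dta_time n inst_w b (inst_c m1 m2 \<epsilon>)"
    unfolding dta_time_eq
    using loop_time_block[of ?t] result_time(1)
    by (meson add_le_mono le_refl le_trans)
  then have "real (?t + (m2 - 4) ^ 2 + n) \<le> T_dta (m1, m2, \<epsilon>)"
    unfolding T_dta_def by (simp only: prod.case of_nat_le_iff)
  moreover have "real (?t + (m2 - 4) ^ 2 + n)
      = 5 * real m1 + 14 * real m2 + 18 + (real m2 - 4) ^ 2"
    using m2 by (simp add: of_nat_diff)
  ultimately show ?thesis by (simp add: power2_diff)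
qed

lemma dta_time_upper: "T_dta (m1, m2, \<epsilon>) \<le> 60 * (real m1 + real m2 ^ 2)"
proof -
  let ?t = "2 * n + 2 * m1 + 11 * m2 + 18"
  have "dta_time n inst_w b (inst_c m1 m2 \<epsilon>) \<le> ?t + (m2 + 1) * (8 * m2 + 1) + n + m2"
    unfolding dta_time_eq
    using loop_time_le[of block ?t] loop_length_le[of block ?t]
      result_time(2)[of "removal_loop inst_w b (canonical b block ?t)"]
    by (simp add: block_def del: upt_Suc)
  also have "\<dots> = 5 * m1 + 8 * m2 ^ 2 + 24 * m2 + 19" by (simp add: power2_eq_square algebra_simps)
  also have "\<dots> \<le> 60 * (m1 + m2 ^ 2)"
  proof -
    \<comment> \<open>After this substitution the inequality between polynomials in
      \<open>m1\<close> and \<open>y\<close> holds coefficient by coefficient.\<close>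
    obtain y where "m2 = y + 5" using m2 by (metis le_add_diff_inverse2)
    then show ?thesis by (simp add: power2_eq_square algebra_simps)
  qed
  finally have "real (dta_time n inst_w b (inst_c m1 m2 \<epsilon>)) \<le> real (60 * (m1 + m2 ^ 2))"
    by (rule of_nat_mono)
  then show ?thesis by (simp add: T_dta_def)
qed

end

section \<open>Asymptotics\<close>

lemma instances_worst_case: "(m1, m2, \<epsilon>) \<in> instances \<longleftrightarrow> worst_case m1 m2 \<epsilon>"
  by (simp add: instances_def worst_case_def)

lemma T_dta_bigtheta: "T_dta \<in> \<Theta>[principal instances](\<lambda>(m1, m2, \<epsilon>). real m1 + real m2 ^ 2)"
proof (rule bigthetaI)
  show "T_dta \<in> O[principal instances](\<lambda>(m1, m2, \<epsilon>). real m1 + real m2 ^ 2)"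
    by (intro bigoI[where c = 60])
      (auto simp: eventually_principal instances_worst_case T_dta_def
        dest!: worst_case.dta_time_upper)
  show "T_dta \<in> \<Omega>[principal instances](\<lambda>(m1, m2, \<epsilon>). real m1 + real m2 ^ 2)"
    by (intro landau_omega.bigI[where c = 1])
      (auto simp: eventually_principal instances_worst_case T_dta_def
        dest!: worst_case.dta_time_lower)
qed

lemma T_ndta_bigtheta: "T_ndta \<in> \<Theta>[principal instances](\<lambda>(m1, m2, \<epsilon>). (real m1 + real m2) ^ 2)"
proof (rule bigthetaI)
  show "T_ndta \<in> O[principal instances](\<lambda>(m1, m2, \<epsilon>). (real m1 + real m2) ^ 2)"
    by (intro bigoI[where c = 30])
      (auto simp: eventually_principal instances_worst_case T_ndta_def
        dest!: worst_case.ndta_time_upper)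
  show "T_ndta \<in> \<Omega>[principal instances](\<lambda>(m1, m2, \<epsilon>). (real m1 + real m2) ^ 2)"
    by (intro landau_omega.bigI[where c = "1/2"])
      (auto simp: eventually_principal instances_worst_case T_ndta_def
        dest!: worst_case.ndta_time_lower)
qed

text \<open>Used to drop \<open>m2 ^ 2\<close> and \<open>m2\<close> beside \<open>m1\<close> on a
  subfamily; nonnegativity gives the lower bound with constant 1.\<close>

lemma bigtheta_add_dominated:
  fixes f g :: "'a \<Rightarrow> real"
  assumes "\<And>x. f x \<ge> 0" "\<And>x. g x \<ge> 0" "g \<in> O[F](f)"
  shows "(\<lambda>x. f x + g x) \<in> \<Theta>[F](f)"
proof (rule bigthetaI)
  show "(\<lambda>x. f x + g x) \<in> O[F](f)" using assms(3) by (intro sum_in_bigo) auto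
  show "(\<lambda>x. f x + g x) \<in> \<Omega>[F](f)"
    using assms(1,2) by (intro landau_omega.bigI[where c = 1]) auto
qed

theorem theorem7:
  shows "T_dta \<in> \<Theta>[principal instances](\<lambda>(m1, m2, \<epsilon>). real m1 + real m2 ^ 2)
    \<and> T_ndta \<in> \<Theta>[principal instances](\<lambda>(m1, m2, \<epsilon>). (real m1 + real m2) ^ 2)
    \<and> (\<forall>F :: (nat \<times> nat \<times> real) filter.
         F \<le> principal instances
         \<and> (\<lambda>(m1, m2, \<epsilon>). real m2 ^ 2) \<in> \<Theta>[F](\<lambda>(m1, m2, \<epsilon>). real m1)
         \<longrightarrow> T_dta \<in> \<Theta>[F](\<lambda>(m1, m2, \<epsilon>). real m1)
           \<and> T_ndta \<in> \<Theta>[F](\<lambda>(m1, m2, \<epsilon>). real m1 ^ 2))"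
proof (intro conjI T_dta_bigtheta T_ndta_bigtheta allI impI; elim conjE)
  fix F :: "(nat \<times> nat \<times> real) filter"
  assume F: "F \<le> principal instances"
    and m: "(\<lambda>(m1, m2, \<epsilon>). real m2 ^ 2) \<in> \<Theta>[F](\<lambda>(m1, m2, \<epsilon>). real m1)"
  let ?m1 = "\<lambda>x :: nat \<times> nat \<times> real. real (fst x)"
  let ?m2 = "\<lambda>x :: nat \<times> nat \<times> real. real (fst (snd x))"
  have m': "(\<lambda>x. ?m2 x ^ 2) \<in> O[F](?m1)" using m by (simp add: case_prod_unfold bigthetaD1)
  have "T_dta \<in> \<Theta>[F](\<lambda>x. ?m1 x + ?m2 x ^ 2)"
    using landau_theta.filter_mono[OF F] T_dta_bigtheta by (simp add: case_prod_unfold)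
  also have "(\<lambda>x. ?m1 x + ?m2 x ^ 2) \<in> \<Theta>[F](?m1)"
    using m' by (intro bigtheta_add_dominated) auto
  finally show "T_dta \<in> \<Theta>[F](\<lambda>(m1, m2, \<epsilon>). real m1)" by (simp add: case_prod_unfold)
  \<comment> \<open>For naturals \<open>m2 \<le> m2 ^ 2\<close>, so the hypothesis on
    \<open>m2 ^ 2\<close> also makes \<open>m2\<close> of order at most \<open>m1\<close>. Then
    \<open>m1 + m2\<close> is of order \<open>m1\<close>, and squaring gives the claim for
    NDTA.\<close>
  have "real k \<le> real k ^ 2" for k
    by (metis le_square power2_eq_square of_nat_mono of_nat_power)
  then have "?m2 \<in> O[F](\<lambda>x. ?m2 x ^ 2)" by (intro bigoI[where c = 1]) auto
  then have "?m2 \<in> O[F](?m1)" using m' by (rule landau_o.big_trans)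
  then have sum: "(\<lambda>x. ?m1 x + ?m2 x) \<in> \<Theta>[F](?m1)" by (intro bigtheta_add_dominated) auto
  have "T_ndta \<in> \<Theta>[F](\<lambda>x. (?m1 x + ?m2 x) ^ 2)"
    using landau_theta.filter_mono[OF F] T_ndta_bigtheta by (simp add: case_prod_unfold)
  also have "(\<lambda>x. (?m1 x + ?m2 x) ^ 2) \<in> \<Theta>[F](\<lambda>x. ?m1 x ^ 2)"
    using sum
    by (intro bigthetaI landau_o.big_power landau_omega.big_power) (auto dest: bigthetaD1 bigthetaD2)
  finally show "T_ndta \<in> \<Theta>[F](\<lambda>(m1, m2, \<epsilon>). real m1 ^ 2)" by (simp add: case_prod_unfold)
qed

end
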